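(* For each integer $B\ge 2$, suppose the card labels of a deck are independent and uniformly distributed on $\{1,2,\dots,B\}$, and that the subject and the magician each choose a secret number uniformly from $\{1,\dots,B\}$, independently of each other and of the deck. Let $t$ be the coupling time of the two Kruskal counts performed on this common deck. Then there are constants $\alpha_B$, $B\ge2$, with $$\alpha_B=\frac{4}{B^2}+O\!\left(\frac1{B^3}\right)\quad\text{as } B\to\infty,$$ such that for each $B$ $$\mathrm{Prob}[t>N]=\exp\bigl(-\alpha_B(1+o(1))N\bigr)\qquad\text{as } N\to\infty .$$
   Context: Kruskal counting procedure: the cards of a deck are in positions $1,2,3,\dots$, and the card in position $m$ carries a positive integer label $v_m$. A player with secret number $s\ge 1$ has first key card at position $s$; if a key card is at position $m$, the next key card is at position $m+v_m$. Both players use the same deck (the same labels $v_m$). Coupling time: $t$ is the smallest position $M$ such that the card in position $M$ is a key card for both the magician and the subject ($t=+\infty$ if there is none). The event $[t>N]$ is the event that magician and subject have no common key card in positions $1$ through $N$; it depends only on the first $N$ cards and the secret numbers, so one may take the deck to be an infinite i.i.d. sequence of labels. *)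

theory Defs
  imports "HOL-Probability.Probability" "HOL-Library.Landau_Symbols"
begin

inductive_set key_cards :: "(nat \<Rightarrow> nat) \<Rightarrow> nat \<Rightarrow> nat set"
  for v :: "nat \<Rightarrow> nat" and s :: nat where
  first: "s \<in> key_cards v s"
| jump: "m \<in> key_cards v s \<Longrightarrow> m + v m \<in> key_cards v s"

text \<open>The infimum of the empty set in \<^typ>\<open>enat\<close> is \<open>\<infinity>\<close>.\<close>

definition coupling_time :: "(nat \<Rightarrow> nat) \<Rightarrow> nat \<Rightarrow> nat \<Rightarrow> enat" where
  "coupling_time v r s = (INF M \<in> key_cards v r \<inter> key_cards v s. enat M)"

definition uniform_label :: "nat \<Rightarrow> nat measure" where
  "uniform_label B = measure_pmf (pmf_of_set {1..B})"

text \<open>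
  The joint law of (magician's number, subject's number, deck). Product measures encode the
  independence of all components. Card positions start at 1.
\<close>

definition kruskal_measure :: "nat \<Rightarrow> (nat \<times> nat \<times> (nat \<Rightarrow> nat)) measure" where
  "kruskal_measure B =
     uniform_label B \<Otimes>\<^sub>M uniform_label B \<Otimes>\<^sub>M (\<Pi>\<^sub>M m\<in>{1..}. uniform_label B)"

end

theory Submission imports Defs begin

text \<open>
  Let always the player whose current key card is behind jump. If the other player is \<open>d\<close>
  positions ahead and the label is \<open>x\<close>, the rear position advances by \<open>min d x\<close>, the new gap
  is the distance of \<open>d\<close> and \<open>x\<close>, and the counts couple iff \<open>x = d\<close>. The
  probability of surviving \<open>n\<close> further positions thus obeys a finite recursion. It is
  submultiplicative in \<open>n\<close> up to a constant factor, since any gap is reached from gap 1 in one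
  jump, so Fekete's lemma yields an exponential decay rate. Positive super- and subsolutions
  \<open>h\<close> of the eigenvalue equation \<open>B * h d = (\<Sum>x\<noteq>d. exp (a * min d x) * h \<bar>d - x\<bar>)\<close> bound this rate
  from below and above by \<open>a\<close>; taking \<open>h d = 1 + k * d\<close> and \<open>a = 2 * k\<close> with \<open>k\<close> close to
  \<open>2 / B\<^sup>2\<close> gives \<open>4 / B\<^sup>2\<close> up to \<open>O(1 / B\<^sup>3)\<close>.
\<close>

subsection \<open>The survival recursion\<close>

text \<open>\<open>n\<close> counts the positions beyond the rear key card, and \<open>d\<close> is
  the gap. If \<open>n < d\<close>, the front key card already lies outside the window, so no
  coupling can occur inside it. The clause \<open>d = 0\<close> ensures termination, and its value
  is never reached from \<open>1 \<le> d\<close> because the label \<open>x = d\<close> is left out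
  of the sum.\<close>

function survival :: "nat \<Rightarrow> nat \<Rightarrow> nat \<Rightarrow> real" where
  "survival B n d =
     (if n < d \<or> d = 0 then 1
      else (\<Sum>x\<in>{1..B} - {d}. survival B (n - min d x) (max d x - min d x)) / real B)"
  by auto
termination
  by (relation "Wellfounded.measure (\<lambda>(B, n, d). n)") auto

declare survival.simps [simp del]

lemma survival_stop: "n < d \<Longrightarrow> survival B n d = 1"
  by (simp add: survival.simps)

lemma survival_step:
  assumes "1 \<le> d" "d \<le> n"
  shows "survival B n d =
    (\<Sum>x\<in>{1..B} - {d}. survival B (n - min d x) (max d x - min d x)) / real B"
  using assms by (subst survival.simps) simp

lemma gap_bounds:
  fixes d x B :: nat
  assumes "x \<in> {1..B} - {d}" "1 \<le> d" "d < B"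
  shows "1 \<le> max d x - min d x" "max d x - min d x < B"
  using assms by auto

text \<open>Induction along the recursion with the invariant of \<open>gap_bounds\<close> built in,
  so that gaps never leave the range 1 to \<open>B - 1\<close>.\<close>

lemma survival_induct [consumes 2, case_names stop step]:
  fixes n d B :: nat
  assumes "1 \<le> d" "d < B"
    and stop: "\<And>n d. 1 \<le> d \<Longrightarrow> d < B \<Longrightarrow> n < d \<Longrightarrow> P n d"
    and step: "\<And>n d. 1 \<le> d \<Longrightarrow> d < B \<Longrightarrow> d \<le> n \<Longrightarrow>
      (\<And>x. x \<in> {1..B} - {d} \<Longrightarrow> P (n - min d x) (max d x - min d x)) \<Longrightarrow> P n d"
  shows "P n d"
  using assms(1,2)
proof (induction n arbitrary: d rule: less_induct)
  case (less n)
  show ?case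
  proof (cases "n < d")
    case False
    have "P (n - min d x) (max d x - min d x)" if x: "x \<in> {1..B} - {d}" for x
    proof (rule less.IH)
      show "n - min d x < n" using less.prems x False by auto
    qed (use gap_bounds[OF x less.prems] in auto)
    from step[OF less.prems _ this] False show ?thesis by simp
  qed (use less.prems stop in auto)
qed

lemma survival_nonneg: "1 \<le> d \<Longrightarrow> d < B \<Longrightarrow> 0 \<le> survival B n d"
proof (induction n d rule: survival_induct)
  case (step n d)
  then show ?case
    unfolding survival_step[OF step.hyps(1,3)]
    by (intro divide_nonneg_nonneg sum_nonneg step.IH) auto
qed (simp add: survival_stop)

lemma survival_le_1: "1 \<le> d \<Longrightarrow> d < B \<Longrightarrow> survival B n d \<le> 1"
proof (induction n d rule: survival_induct)
  case (step n d)
  have "(\<Sum>x\<in>{1..B} - {d}. survival B (n - min d x) (max d x - min d x))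
      \<le> (\<Sum>x\<in>{1..B} - {d}. 1)"
    by (intro sum_mono step.IH)
  also have "\<dots> \<le> real B" using card_mono[of "{1..B}" "{1..B} - {d}"] by simp
  finally show ?case using step.hyps by (simp add: survival_step)
qed (simp add: survival_stop)

lemma survival_decreasing:
  "1 \<le> d \<Longrightarrow> d < B \<Longrightarrow> survival B (n + k) d \<le> survival B n d"
proof (induction n d rule: survival_induct)
  case (step n d)
  have "(\<Sum>x\<in>{1..B} - {d}. survival B (n + k - min d x) (max d x - min d x))
      \<le> (\<Sum>x\<in>{1..B} - {d}. survival B (n - min d x) (max d x - min d x))"
  proof (rule sum_mono)
    fix x assume x: "x \<in> {1..B} - {d}"
    have "n + k - min d x = n - min d x + k" using step.hyps by simp
    then show "survival B (n + k - min d x) (max d x - min d x)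
        \<le> survival B (n - min d x) (max d x - min d x)"
      using step.IH[OF x] by simp
  qed
  then show ?case using step.hyps by (simp add: survival_step divide_right_mono)
qed (simp add: survival_stop survival_le_1)

lemma survival_antimono:
  assumes "1 \<le> d" "d < B" "n \<le> m"
  shows "survival B m d \<le> survival B n d"
  using survival_decreasing[OF assms(1,2), of n "m - n"] assms(3) by simp

text \<open>Each transition has probability 1/B, and a single summand is at most the whole sum. Past
  the stopping time both sides are trivial, since the value is then 1.\<close>

lemma survival_ge_successor:
  assumes "1 \<le> d" "d < B" "x \<in> {1..B} - {d}"
  shows "survival B (n - min d x) (max d x - min d x) \<le> real B * survival B n d"
proof (cases "n < d")
  case True
  then show ?thesis
    using survival_le_1[OF gap_bounds[OF assms(3,1,2)], of "n - min d x"] assms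
    by (simp add: survival_stop)
next
  case False
  have "survival B (n - min d x) (max d x - min d x)
      \<le> (\<Sum>x\<in>{1..B} - {d}. survival B (n - min d x) (max d x - min d x))"
    by (rule member_le_sum) (use assms in \<open>auto intro: survival_nonneg gap_bounds\<close>)
  then show ?thesis using assms False by (simp add: survival_step)
qed

text \<open>From gap 1 the label \<open>d + 1\<close>, admissible because \<open>d < B\<close>,
  moves the rear by one position and produces gap \<open>d\<close>.\<close>

lemma survival_1_ge:
  assumes "1 \<le> d" "d < B"
  shows "survival B (n - 1) d \<le> real B * survival B n 1"
  using survival_ge_successor[of 1 B "Suc d" n] assms by (simp add: max_def min_def)

text \<open>Unfold the recursion until the first \<open>n\<close> positions are used up. From the
  gap then present, the remaining \<open>m\<close> positions are compared with a start at gap 1,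
  which costs the factor \<open>B\<close>.\<close>

lemma survival_submult:
  assumes "1 \<le> d" "d < B"
  shows "survival B (n + m) d \<le> real B * survival B n d * survival B m 1"
  using assms
proof (induction n d rule: survival_induct)
  case (stop n d)
  \<comment> \<open>The horizon is shortened to \<open>m - 1\<close> because the jump from gap 1 to
    gap \<open>d\<close> uses one position.\<close>
  have "survival B (n + m) d \<le> survival B (m - 1) d"
    using stop by (intro survival_antimono) auto
  also have "\<dots> \<le> real B * survival B m 1"
    using stop by (intro survival_1_ge) auto
  finally show ?case using stop by (simp add: survival_stop)
next
  case (step n d)
  have "(\<Sum>x\<in>{1..B} - {d}. survival B (n + m - min d x) (max d x - min d x))
      \<le> (\<Sum>x\<in>{1..B} - {d}. real B * survival B (n - min d x) (max d x - min d x) * survival B m 1)"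
  proof (rule sum_mono)
    fix x assume x: "x \<in> {1..B} - {d}"
    have "n + m - min d x = n - min d x + m" using step.hyps by simp
    then show "survival B (n + m - min d x) (max d x - min d x)
        \<le> real B * survival B (n - min d x) (max d x - min d x) * survival B m 1"
      using step.IH[OF x] by simp
  qed
  also have "\<dots> = real B * (\<Sum>x\<in>{1..B} - {d}. survival B (n - min d x) (max d x - min d x)) * survival B m 1"
    by (simp add: sum_distrib_left sum_distrib_right)
  finally show ?case
    using step.hyps by (simp add: survival_step pos_divide_le_eq mult_ac)
qed

subsection \<open>Comparison with super- and subsolutions\<close>

text \<open>The condition on \<open>h\<close> says that \<open>exp (- (a * n)) * h d\<close>
  dominates its own average under one jump. The factor \<open>exp (a * B)\<close> lifts it above the
  stopping value 1, because stopping happens at some \<open>n < d < B\<close>.\<close>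

lemma survival_le_supersolution:
  fixes h :: "nat \<Rightarrow> real"
  assumes "0 \<le> a" and h1: "\<And>d. 1 \<le> d \<Longrightarrow> d < B \<Longrightarrow> 1 \<le> h d"
    and super: "\<And>d. 1 \<le> d \<Longrightarrow> d < B \<Longrightarrow>
      (\<Sum>x\<in>{1..B} - {d}. exp (a * real (min d x)) * h (max d x - min d x)) \<le> B * h d"
    and "1 \<le> d" "d < B"
  shows "survival B n d \<le> exp (a * B) * exp (- (a * n)) * h d"
  using assms(4,5)
proof (induction n d rule: survival_induct)
  case (stop n d)
  have "1 \<le> exp (a * B) * exp (- (a * n))"
    using stop \<open>0 \<le> a\<close> by (simp flip: exp_add add: mult_left_mono)
  from mult_mono[OF this h1[OF stop(1,2)]] show ?case
    using stop by (simp add: survival_stop)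
next
  case (step n d)
  have "(\<Sum>x\<in>{1..B} - {d}. survival B (n - min d x) (max d x - min d x))
      \<le> (\<Sum>x\<in>{1..B} - {d}. exp (a * B) * exp (- (a * n)) *
          (exp (a * real (min d x)) * h (max d x - min d x)))"
  proof (rule sum_mono)
    fix x assume x: "x \<in> {1..B} - {d}"
    have "exp (- (a * real (n - min d x))) = exp (- (a * n)) * exp (a * real (min d x))"
      using step.hyps by (simp flip: exp_add add: of_nat_diff algebra_simps)
    then show "survival B (n - min d x) (max d x - min d x) \<le> exp (a * B) * exp (- (a * n)) *
          (exp (a * real (min d x)) * h (max d x - min d x))"
      using step.IH[OF x] by (simp add: algebra_simps)
  qed
  also have "\<dots> \<le> exp (a * B) * exp (- (a * n)) * (B * h d)"
    unfolding sum_distrib_left[symmetric] using super[OF step.hyps(1,2)]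
    by (intro mult_left_mono) auto
  finally show ?case using step.hyps by (simp add: survival_step pos_divide_le_eq mult_ac)
qed

text \<open>The mirror image of the previous comparison; here \<open>c\<close> scales
  \<open>h\<close> below the stopping value 1.\<close>

lemma survival_ge_subsolution:
  fixes h :: "nat \<Rightarrow> real"
  assumes "0 \<le> a" "0 \<le> c" and h1: "\<And>d. 1 \<le> d \<Longrightarrow> d < B \<Longrightarrow> 0 \<le> h d \<and> c * h d \<le> 1"
    and sub: "\<And>d. 1 \<le> d \<Longrightarrow> d < B \<Longrightarrow>
      B * h d \<le> (\<Sum>x\<in>{1..B} - {d}. exp (a * real (min d x)) * h (max d x - min d x))"
    and "1 \<le> d" "d < B"
  shows "c * exp (- (a * n)) * h d \<le> survival B n d"
  using assms(5,6)
proof (induction n d rule: survival_induct)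
  case (stop n d)
  have "exp (- (a * n)) * (c * h d) \<le> 1 * 1"
    using h1[OF stop(1,2)] \<open>0 \<le> a\<close> \<open>0 \<le> c\<close> by (intro mult_mono) auto
  then show ?case using stop by (simp add: survival_stop mult_ac)
next
  case (step n d)
  have "c * exp (- (a * n)) * (B * h d) \<le> c * exp (- (a * n)) *
      (\<Sum>x\<in>{1..B} - {d}. exp (a * real (min d x)) * h (max d x - min d x))"
    using sub[OF step.hyps(1,2)] \<open>0 \<le> c\<close> by (intro mult_left_mono) auto
  also have "\<dots> \<le> (\<Sum>x\<in>{1..B} - {d}. survival B (n - min d x) (max d x - min d x))"
    unfolding sum_distrib_left
  proof (rule sum_mono)
    fix x assume x: "x \<in> {1..B} - {d}"
    have "exp (- (a * real (n - min d x))) = exp (- (a * n)) * exp (a * real (min d x))"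
      using step.hyps by (simp flip: exp_add add: of_nat_diff algebra_simps)
    then show "c * exp (- (a * n)) *
          (exp (a * real (min d x)) * h (max d x - min d x)) \<le> survival B (n - min d x) (max d x - min d x)"
      using step.IH[OF x] by (simp add: algebra_simps)
  qed
  finally show ?case using step.hyps by (simp add: survival_step pos_le_divide_eq mult_ac)
qed

text \<open>The first-order form of the eigenvalue equation. Excluding the label \<open>d\<close>
  costs \<open>1 + 2 * k * d\<close>. The sum differs from \<open>B * (1 + k * d)\<close> by
  \<open>k * (B * (B + 1) / 2 - 2 * d) - 1\<close>, and balancing this defect puts \<open>k\<close>
  near 2/B^2.\<close>

lemma sum_labels:
  fixes k :: real
  assumes "1 \<le> d" "d < B"
  shows "(\<Sum>x\<in>{1..B} - {d}. 1 + k * (real d + real x))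
    = B * (1 + k * d) - 1 + k * (real B * (real B + 1) / 2 - 2 * d)"
proof -
  have "(\<Sum>x\<in>{1..B}. real x) = real B * (real B + 1) / 2"
    by (induction B) (auto simp: field_simps)
  then have "(\<Sum>x\<in>{1..B}. 1 + k * (real d + real x)) = B * (1 + k * d) + k * (real B * (real B + 1) / 2)"
    by (simp add: sum.distrib flip: sum_distrib_left) (simp add: algebra_simps)
  then show ?thesis using assms by (simp add: sum_diff1 algebra_simps)
qed

text \<open>
  This is why the linear function \<open>1 + k * d\<close> nearly solves the eigenvalue equation at rate
  \<open>2 * k\<close>: to first order, the effect of a label \<open>x\<close> does not distinguish
  which of the two walkers ends up behind.
\<close>
lemma min_plus_gap: "2 * real (min d x) + real (max d x - min d x) = real d + real x"
  by (simp add: min_def max_def of_nat_diff)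

lemma survival_lower:
  assumes "2 \<le> B" "1 \<le> d" "d < B"
  shows "\<exists>c>0. \<forall>n. c * exp (- (4 / (real B ^ 2 - 3 * B + 4) * n)) \<le> survival B n d"
proof -
  \<comment> \<open>This \<open>k\<close> makes the defect in \<open>sum_labels\<close> vanish at
    the largest gap \<open>B - 1\<close>, hence nonnegative at every gap. Completing the square, (B
    - 3/2)^2 + 7/4, shows that the denominator is positive.\<close>
  define k where "k = 2 / (real B ^ 2 - 3 * B + 4)"
  have pos: "real B ^ 2 - 3 * B + 4 > 0"
    using sum_squares_gt_zero_iff[of "real B - 3/2" 1] by (simp add: power2_eq_square algebra_simps)
  then have k: "k > 0" by (simp add: k_def)
  have "real B * (real B + 1) / 2 - 2 * (real B - 1) = (real B ^ 2 - 3 * B + 4) / 2"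
    by (simp add: field_simps power2_eq_square)
  with pos have k_eq: "k * (real B * (real B + 1) / 2 - 2 * (real B - 1)) = 1"
    by (simp add: k_def)
  have ge: "exp (2 * k * real (min e x)) * (1 + k * real (max e x - min e x)) \<ge> 1 + k * (real e + real x)"
    for e x :: nat
  proof -
    define p q where "p = 2 * k * real (min e x)" and "q = k * real (max e x - min e x)"
    have pq: "0 \<le> p" "0 \<le> q" using k by (auto simp: p_def q_def)
    have "1 + k * (real e + real x) = 1 + p + q"
      unfolding p_def q_def min_plus_gap[symmetric] by (simp add: algebra_simps)
    also have "\<dots> \<le> (1 + p) * (1 + q)"
      using pq by (simp add: algebra_simps)
    also have "\<dots> \<le> exp p * (1 + q)"
      using pq by (intro mult_right_mono exp_ge_add_one_self) auto
    finally show ?thesis by (simp add: p_def q_def)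
  qed
  \<comment> \<open>The prefactor normalises \<open>1 + k * d\<close> to at most 1 for all
    gaps.\<close>
  have "1 / (1 + k * B) * exp (- (2 * k * n)) * (1 + k * d) \<le> survival B n d" for n
  proof (rule survival_ge_subsolution)
    fix e assume e: "1 \<le> e" "e < B"
    show "0 \<le> 1 + k * real e \<and> 1 / (1 + k * real B) * (1 + k * real e) \<le> 1"
      using k e by (simp add: divide_simps add_pos_nonneg)
    have "k * (real B * (real B + 1) / 2 - 2 * e) \<ge> k * (real B * (real B + 1) / 2 - 2 * (real B - 1))"
      using k e by (intro mult_left_mono) auto
    then have "real B * (1 + k * real e) \<le> (\<Sum>x\<in>{1..B} - {e}. 1 + k * (real e + real x))"
      unfolding sum_labels[OF e] k_eq by simp
    also have "\<dots> \<le> (\<Sum>x\<in>{1..B} - {e}. exp (2 * k * real (min e x)) * (1 + k * real (max e x - min e x)))"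
      by (intro sum_mono ge)
    finally show "real B * (1 + k * real e) \<le> \<dots>" .
  qed (use k assms in auto)
  then show ?thesis
    using k by (intro exI[of _ "1 / (1 + k * B) * (1 + k * d)"])
      (auto simp: k_def mult_ac intro!: divide_pos_pos mult_pos_pos add_pos_nonneg)
qed

text \<open>A crude bound valid for every \<open>B \<ge> 2\<close>, used to show that the decay rate
  is strictly positive. With constant \<open>h\<close> and every advance replaced by
  \<open>B\<close>, the condition becomes \<open>(B - 1) * exp (a * B) = B\<close>, which determines
  \<open>a\<close>.\<close>

lemma survival_upper_weak:
  assumes "2 \<le> B" "1 \<le> d" "d < B"
  shows "survival B n d \<le> exp (ln (B / (real B - 1))) * exp (- (ln (B / (real B - 1)) / B * n))"
proof -
  define a where "a = ln (B / (real B - 1)) / B"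
  have a: "0 \<le> a" using assms by (simp add: a_def)
  have aB: "a * B = ln (B / (real B - 1))" using assms by (simp add: a_def)
  have "survival B n d \<le> exp (a * B) * exp (- (a * n)) * 1"
  proof (rule survival_le_supersolution[where h = "\<lambda>_. 1"])
    fix e assume e: "1 \<le> e" "e < B"
    have "(\<Sum>x\<in>{1..B} - {e}. exp (a * real (min e x)) * 1) \<le> (\<Sum>x\<in>{1..B} - {e}. exp (a * real B))"
      using a e by (intro sum_mono) (auto intro!: mult_left_mono)
    also have "\<dots> = (real B - 1) * exp (a * B)"
      using e by (simp add: card_Diff_subset of_nat_diff)
    also have "\<dots> = real B * 1"
      unfolding aB using assms by (subst exp_ln) auto
    finally show "(\<Sum>x\<in>{1..B} - {e}. exp (a * real (min e x)) * 1) \<le> real B * 1" .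
  qed (use a assms in auto)
  then show ?thesis by (simp add: aB) (simp add: a_def)
qed

lemma survival_upper:
  assumes "32 \<le> B" "1 \<le> d" "d < B"
  shows "\<exists>c>0. \<forall>n. survival B n d \<le>
    c * exp (- (4 * (1 - 32 / B) / (real B * (real B + 1)) * n))"
proof -
  \<comment> \<open>For the upper bound the term \<open>- 2 * e\<close> of the defect is dropped.
    The share 32/B is held back to pay for an error of 32/B^2 on each of the \<open>B - 1\<close>
    labels; \<open>B \<ge> 32\<close> keeps \<open>k\<close> nonnegative.\<close>
  define k where "k = 2 * (1 - 32 / B) / (real B * (real B + 1))"
  have k: "k \<ge> 0"
    unfolding k_def using assms by (intro divide_nonneg_nonneg mult_nonneg_nonneg) auto
  have k_eq: "k * (real B * (real B + 1) / 2) = 1 - 32 / B"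
    using assms by (auto simp: k_def divide_simps)
  have "k \<le> 2 / (real B * B)"
    unfolding k_def using assms by (intro frac_le) (auto intro!: mult_left_mono)
  then have kB: "k * B \<le> 2 / B"
    using assms by (simp add: field_simps)
  have le: "exp (2 * k * real (min e x)) * (1 + k * real (max e x - min e x))
      \<le> 1 + k * (real e + real x) + 32 / B ^ 2"
    if e: "e < B" "x \<le> B" for e x :: nat
  proof -
    define p q where "p = 2 * k * real (min e x)" and "q = k * real (max e x - min e x)"
    have "p \<le> 2 * (k * B)"
      unfolding p_def mult.assoc using e k by (intro mult_left_mono) auto
    with kB have p: "0 \<le> p" "p \<le> 4 / B" using k by (auto simp: p_def)
    have "q \<le> k * B"
      unfolding q_def using e k by (intro mult_left_mono) auto
    with kB have q: "0 \<le> q" "q \<le> 2 / B" using k by (auto simp: q_def)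
    have B: "4 / real B \<le> 1" "2 / real B \<le> 1/2" using assms by (auto simp: divide_simps)
    have "exp p * (1 + q) \<le> (1 + p + p\<^sup>2) * (1 + q)"
      using p q B by (intro mult_right_mono exp_bound) auto
    also have "\<dots> = 1 + (p + q) + (p\<^sup>2 + p * q + p\<^sup>2 * q)"
      by (simp add: algebra_simps)
    \<comment> \<open>The constant is 32 = 16 + 8 + 8, from p at most 4/B and q at most both 2/B and
      1/2.\<close>
    also have "p\<^sup>2 + p * q + p\<^sup>2 * q \<le> (4 / B)\<^sup>2 + 4 / B * (2 / B) + (4 / B)\<^sup>2 * (1 / 2)"
      using p q B by (intro add_mono mult_mono power_mono) auto
    also have "\<dots> = 32 / B ^ 2" by (simp add: power2_eq_square)
    also have "p + q = k * (real e + real x)"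
      unfolding p_def q_def min_plus_gap[symmetric] by (simp add: algebra_simps)
    finally show ?thesis by (simp add: p_def q_def)
  qed
  have "survival B n d \<le> exp (2 * k * B) * exp (- (2 * k * n)) * (1 + k * d)" for n
  proof (rule survival_le_supersolution)
    fix e assume e: "1 \<le> e" "e < B"
    have "(\<Sum>x\<in>{1..B} - {e}. exp (2 * k * real (min e x)) * (1 + k * real (max e x - min e x)))
        \<le> (\<Sum>x\<in>{1..B} - {e}. 1 + k * (real e + real x) + 32 / B ^ 2)"
      using e by (intro sum_mono le) auto
    also have "\<dots> = B * (1 + k * e) - 1 + k * (real B * (real B + 1) / 2 - 2 * e)
        + (real B - 1) * (32 / B ^ 2)"
      using e by (subst sum.distrib, subst sum_labels) (auto simp: card_Diff_subset of_nat_diff)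
    also have "k * (real B * (real B + 1) / 2 - 2 * e) \<le> 1 - 32 / B"
      unfolding k_eq[symmetric] using k by (intro mult_left_mono) auto
    also have "(real B - 1) * (32 / B ^ 2) \<le> 32 / B"
      using assms by (simp add: field_simps power2_eq_square)
    finally show "(\<Sum>x\<in>{1..B} - {e}. exp (2 * k * real (min e x)) *
        (1 + k * real (max e x - min e x))) \<le> real B * (1 + k * real e)"
      by simp
  qed (use k assms in auto)
  moreover have "4 * (1 - 32 / B) / (real B * (real B + 1)) = 2 * k" by (simp add: k_def)
  moreover have "0 < exp (2 * k * B) * (1 + k * d)"
    using k by (intro mult_pos_pos add_pos_nonneg) auto
  ultimately show ?thesis
    by (intro exI[of _ "exp (2 * k * B) * (1 + k * d)"]) (simp only: mult_ac simp_thms)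
qed

section \<open>Fekete's lemma and the decay rate\<close>

lemma fekete:
  fixes g :: "nat \<Rightarrow> real"
  assumes sub: "\<And>m n. g (m + n) \<le> g m + g n" and lower: "\<And>n. L * n \<le> g n"
  shows "convergent (\<lambda>n. g n / n)"
proof -
  define l where "l = (INF n\<in>{1..}. g n / real n)"
  have bdd: "bdd_below ((\<lambda>n. g n / real n) ` {1..})"
    using lower by (intro bdd_belowI2[of _ L]) (auto simp: divide_simps mult.commute)
  have ge: "l \<le> g n / n" if "n \<ge> 1" for n
    unfolding l_def using that by (intro cINF_lower bdd) auto
  have mul: "g (q * m + r) \<le> q * g m + g r" for q m r
  proof (induction q)
    case (Suc q)
    have "g (Suc q * m + r) \<le> g m + g (q * m + r)"
      using sub[of m "q * m + r"] by (simp add: add_ac)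
    with Suc show ?case by (simp add: algebra_simps)
  qed simp
  have "(\<lambda>n. g n / n) \<longlonglongrightarrow> l"
  proof (rule order_tendstoI)
    fix y assume "y < l"
    have "\<forall>\<^sub>F n in sequentially. l \<le> g n / real n"
      using eventually_ge_at_top[of 1] by (rule eventually_mono) (rule ge)
    then show "\<forall>\<^sub>F n in sequentially. y < g n / real n"
      by eventually_elim (use \<open>y < l\<close> in auto)
  next
    fix y assume "l < y"
    then obtain m where m: "m \<ge> 1" "g m / real m < y"
      unfolding l_def using cINF_less_iff[OF _ bdd] by auto
    \<comment> \<open>Dividing \<open>n\<close> by \<open>m\<close> leaves two errors bounded
      independently of \<open>n\<close>: the value of \<open>g\<close> at the remainder, and the
      fraction of \<open>g m\<close> lost by rounding \<open>n / m\<close> down.\<close>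
    define C where "C = (MAX r\<in>{..<m}. \<bar>g r\<bar>) + \<bar>g m\<bar>"
    have bound: "g n / n \<le> g m / m + C / n" if n: "n \<ge> 1" for n
    proof -
      have "\<bar>g (n mod m)\<bar> \<le> (MAX r\<in>{..<m}. \<bar>g r\<bar>)"
        using m by (intro Max_ge) auto
      moreover have "g n \<le> (n div m) * g m + g (n mod m)"
        using mul[of "n div m" m "n mod m"] by simp
      moreover have "real (n div m) * g m \<le> n * (g m / m) + \<bar>g m\<bar>"
      proof -
        have "real n = real (n div m) * m + real (n mod m)"
          by (metis div_mult_mod_eq of_nat_add of_nat_mult)
        then have "real (n div m) * g m = n * (g m / m) - real (n mod m) / m * g m"
          using m by (simp add: field_simps)
        moreover have "\<bar>real (n mod m) / m * g m\<bar> \<le> 1 * \<bar>g m\<bar>"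
          unfolding abs_mult using m
          by (intro mult_right_mono) (auto simp: divide_simps intro: less_imp_le)
        ultimately show ?thesis by linarith
      qed
      ultimately have "g n \<le> n * (g m / m) + C" unfolding C_def by linarith
      then have "g n / n \<le> (n * (g m / m) + C) / n" by (intro divide_right_mono) auto
      then show ?thesis using n by (simp add: add_divide_distrib)
    qed
    have "(\<lambda>n. g m / m + C / real n) \<longlonglongrightarrow> g m / m + 0"
      by (intro tendsto_intros lim_const_over_n)
    then have "\<forall>\<^sub>F n in sequentially. g m / m + C / real n < y"
      using m by (intro order_tendstoD) auto
    then show "\<forall>\<^sub>F n in sequentially. g n / real n < y"
      using eventually_ge_at_top[of 1]
      by eventually_elim (use bound in \<open>auto intro: le_less_trans\<close>)
  qed
  then show ?thesis by (rule convergentI)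
qed

lemma survival_pos:
  assumes "1 \<le> d" "d < B"
  shows "survival B n d > 0"
proof -
  obtain c where "c > 0" "c * exp (- (4 / (real B ^ 2 - 3 * B + 4) * n)) \<le> survival B n d"
    using survival_lower[of B d] assms by auto
  then show ?thesis by (smt (verit) exp_gt_zero mult_pos_pos)
qed

text \<open>Gap 1 serves as reference state; other gaps and random starts change the survival
  probability only by factors independent of \<open>n\<close>. That the limit exists is shown in
  \<open>tendsto_decay_rate\<close>.\<close>

definition decay_rate :: "nat \<Rightarrow> real" where
  "decay_rate B = lim (\<lambda>n. - ln (survival B n 1) / n)"

lemma tendsto_decay_rate:
  assumes "2 \<le> B"
  shows "(\<lambda>n. - ln (survival B n 1) / n) \<longlonglongrightarrow> decay_rate B"
proof -
  let ?u = "\<lambda>n. survival B n 1"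
  have pos: "?u n > 0" for n using assms by (intro survival_pos) auto
  \<comment> \<open>The extra factor \<open>B\<close> turns submultiplicativity up to a constant
    into exact subadditivity; it contributes \<open>ln B / n\<close>, which vanishes in the
    limit.\<close>
  define g where "g n = ln (B * ?u n)" for n
  have g_eq: "g n = ln B + ln (?u n)" for n
    unfolding g_def using assms pos[of n] by (subst ln_mult) auto
  obtain c where c: "c > 0" "\<And>n. c * exp (- (4 / (real B ^ 2 - 3 * B + 4) * n)) \<le> ?u n"
    using survival_lower[of B 1] assms by auto
  define b where "b = 4 / (real B ^ 2 - 3 * B + 4)"
  have lower: "ln c - b * n \<le> ln (?u n)" for n
  proof -
    have "ln (c * exp (- (b * n))) \<le> ln (?u n)"
      using c pos[of n] unfolding b_def by (subst ln_le_cancel_iff) auto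
    then show ?thesis using c by (simp add: ln_mult)
  qed
  have "convergent (\<lambda>n. g n / n)"
  proof (rule fekete)
    show "g (m + n) \<le> g m + g n" for m n
    proof -
      have "real B * ?u (m + n) \<le> (B * ?u m) * (B * ?u n)"
        using survival_submult[of 1 B m n] assms by (simp add: mult_ac)
      then have "g (m + n) \<le> ln ((B * ?u m) * (B * ?u n))"
        unfolding g_def using assms pos by (subst ln_le_cancel_iff) auto
      also have "\<dots> = g m + g n"
        unfolding g_def using assms pos[of m] pos[of n] by (subst ln_mult) auto
      finally show ?thesis .
    qed
    \<comment> \<open>Fekete's lemma wants a bound linear in \<open>n\<close>, so the constant
      \<open>ln c\<close> is absorbed into \<open>\<bar>ln c\<bar> * n\<close>. This needs
      \<open>n \<ge> 1\<close>.\<close>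
    show "- (\<bar>ln c\<bar> + b) * n \<le> g n" for n
    proof (cases "n = 0")
      case True
      then show ?thesis using assms by (simp add: g_def survival_stop)
    next
      case False
      then have "\<bar>ln c\<bar> * 1 \<le> \<bar>ln c\<bar> * n" by (intro mult_left_mono) auto
      then have "- (\<bar>ln c\<bar> + b) * n \<le> ln c - b * n" by (simp add: algebra_simps)
      also have "\<dots> \<le> g n" using lower[of n] assms ln_ge_zero[of "real B"] unfolding g_eq by linarith
      finally show ?thesis .
    qed
  qed
  then obtain l where "(\<lambda>n. g n / n) \<longlonglongrightarrow> l" by (auto simp: convergent_def)
  then have "(\<lambda>n. ln B / n - g n / n) \<longlonglongrightarrow> 0 - l"
    by (intro tendsto_intros lim_const_over_n)
  then have "(\<lambda>n. - ln (?u n) / n) \<longlonglongrightarrow> - l"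
    by (simp add: g_eq diff_divide_distrib[symmetric])
  then show ?thesis
    unfolding decay_rate_def by (simp add: limI)
qed

lemma decay_rate_le:
  assumes "2 \<le> B" "c > 0" "\<And>n. c * exp (- (b * n)) \<le> survival B n 1"
  shows "decay_rate B \<le> b"
proof (rule LIMSEQ_le[OF tendsto_decay_rate[OF assms(1)]])
  show "(\<lambda>n. b - ln c / n) \<longlonglongrightarrow> b"
    using tendsto_diff[OF tendsto_const lim_const_over_n] by fastforce
  have "- ln (survival B n 1) / n \<le> b - ln c / n" if "n \<ge> 1" for n
  proof -
    have "ln (c * exp (- (b * n))) \<le> ln (survival B n 1)"
      using assms survival_pos[of 1 B n] by (subst ln_le_cancel_iff) auto
    then have "ln c - b * n \<le> ln (survival B n 1)"
      using assms by (simp add: ln_mult)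
    then have "- ln (survival B n 1) / n \<le> (b * n - ln c) / n"
      by (intro divide_right_mono) auto
    then show ?thesis using that by (simp add: diff_divide_distrib)
  qed
  then show "\<exists>N. \<forall>n\<ge>N. - ln (survival B n 1) / n \<le> b - ln c / n" by blast
qed

lemma decay_rate_ge:
  assumes "2 \<le> B" "c > 0" "\<And>n. survival B n 1 \<le> c * exp (- (b * n))"
  shows "b \<le> decay_rate B"
proof (rule LIMSEQ_le[OF _ tendsto_decay_rate[OF assms(1)]])
  show "(\<lambda>n. b - ln c / n) \<longlonglongrightarrow> b"
    using tendsto_diff[OF tendsto_const lim_const_over_n] by fastforce
  have "b - ln c / n \<le> - ln (survival B n 1) / n" if "n \<ge> 1" for n
  proof -
    have "ln (survival B n 1) \<le> ln (c * exp (- (b * n)))"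
      using assms survival_pos[of 1 B n] by (subst ln_le_cancel_iff) auto
    then have "ln (survival B n 1) \<le> ln c - b * n"
      using assms by (simp add: ln_mult)
    then have "(b * n - ln c) / n \<le> - ln (survival B n 1) / n"
      by (intro divide_right_mono) auto
    then show ?thesis using that by (simp add: diff_divide_distrib)
  qed
  then show "\<exists>N. \<forall>n\<ge>N. b - ln c / n \<le> - ln (survival B n 1) / n" by blast
qed

lemma decay_rate_pos:
  assumes "2 \<le> B"
  shows "decay_rate B > 0"
proof -
  have "0 < ln (B / (real B - 1)) / B" using assms by simp
  also have "\<dots> \<le> decay_rate B"
    using assms by (intro decay_rate_ge[OF _ _ survival_upper_weak]) auto
  finally show ?thesis .
qed

text \<open>The constant is 132 = 4 * 32 + 4: the first part comes from the correction 32/B in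
  \<open>survival_upper\<close>, the second from replacing \<open>B * (B + 1)\<close> by B^2. The
  same constant leaves ample room on the other side.\<close>

lemma decay_rate_asymp: "(\<lambda>B. decay_rate B - 4 / real B ^ 2) \<in> O(\<lambda>B. 1 / real B ^ 3)"
proof (rule bigoI[of _ 132])
  show "\<forall>\<^sub>F B in sequentially. norm (decay_rate B - 4 / real B ^ 2) \<le> 132 * norm (1 / real B ^ 3)"
    using eventually_ge_at_top[of 32]
  proof eventually_elim
    case (elim B)
    have B: "real B \<ge> 32" using elim by simp
    have "decay_rate B \<le> 4 / (real B ^ 2 - 3 * B + 4)"
      using survival_lower[of B 1] elim by (auto intro: decay_rate_le)
    also have "\<dots> \<le> 4 / real B ^ 2 + 132 / real B ^ 3"
    proof -
      define x where "x = real B"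
      have x: "x \<ge> 32" using B by (simp add: x_def)
      have "32 * x \<le> x * x" using x by (intro mult_right_mono) auto
      then have pos: "x * x - 3 * x + 4 > 0" using x by linarith
      have "(4 * x + 132) * (x * x - 3 * x + 4) = 4 * (x * x * x) + 120 * (x * x) - 380 * x + 528"
        by (simp add: algebra_simps)
      with \<open>32 * x \<le> x * x\<close> x have "4 * (x * x * x) \<le> (4 * x + 132) * (x * x - 3 * x + 4)"
        by linarith
      then have "4 / (x * x - 3 * x + 4) \<le> (4 * x + 132) / (x * x * x)"
        using pos x by (subst frac_le_eq) (auto simp: divide_simps mult_ac)
      also have "\<dots> = 4 / (x * x) + 132 / (x * x * x)"
        using x by (simp add: field_simps)
      finally show ?thesis by (simp add: x_def power2_eq_square power3_eq_cube)
    qed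
    finally have upper: "decay_rate B \<le> 4 / real B ^ 2 + 132 / real B ^ 3" .
    have "4 / real B ^ 2 - 132 / real B ^ 3 \<le> 4 * (1 - 32 / B) / (real B * (real B + 1))"
    proof -
      define x where "x = real B"
      have x: "x \<ge> 32" using B by (simp add: x_def)
      have "(4 * x - 132) * (x + 1) \<le> 4 * (x - 32) * x"
        using x by (simp add: algebra_simps)
      then have "(4 * x - 132) / (x * x * x) \<le> 4 * (x - 32) / (x * x * (x + 1))"
        using x by (simp add: divide_simps)
      also have "4 * (x - 32) / (x * x * (x + 1)) = 4 * (1 - 32 / x) / (x * (x + 1))"
        using x by (simp add: divide_simps)
      also have "(4 * x - 132) / (x * x * x) = 4 / (x * x) - 132 / (x * x * x)"
        using x by (simp add: field_simps)
      finally show ?thesis by (simp add: x_def power2_eq_square power3_eq_cube)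
    qed
    also have "\<dots> \<le> decay_rate B"
      using survival_upper[of B 1] elim by (auto intro: decay_rate_ge)
    finally show ?case using upper by (simp add: abs_le_iff)
  qed
qed

subsection \<open>Key cards\<close>

lemma key_cards_ge: "M \<in> key_cards v a \<Longrightarrow> a \<le> M"
  by (induction rule: key_cards.induct) auto

lemma key_cards_step: "key_cards v a = insert a (key_cards v (a + v a))"
proof (intro equalityI subsetI)
  fix M assume "M \<in> key_cards v a"
  then show "M \<in> insert a (key_cards v (a + v a))"
    by (induction rule: key_cards.induct) (auto intro: key_cards.intros)
next
  fix M assume "M \<in> insert a (key_cards v (a + v a))"
  moreover have "M \<in> key_cards v a" if "M \<in> key_cards v (a + v a)"
    using that by (induction rule: key_cards.induct) (auto intro: key_cards.intros)
  ultimately show "M \<in> key_cards v a" by (auto intro: key_cards.intros)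
qed

text \<open>Serves measurability: being a key card becomes a countable disjunction over the number
  of jumps.\<close>

lemma key_cards_eq_range: "key_cards v a = range (\<lambda>i. ((\<lambda>m. m + v m) ^^ i) a)"
proof (intro equalityI subsetI)
  fix M assume "M \<in> key_cards v a"
  then show "M \<in> range (\<lambda>i. ((\<lambda>m. m + v m) ^^ i) a)"
  proof (induction rule: key_cards.induct)
    case first
    show ?case by (rule range_eqI[of _ _ 0]) simp
  next
    case (jump m)
    then obtain i where "m = ((\<lambda>m. m + v m) ^^ i) a" by auto
    then show ?case by (intro range_eqI[of _ _ "Suc i"]) simp
  qed
next
  have "((\<lambda>m. m + v m) ^^ i) a \<in> key_cards v a" for i
    by (induction i) (auto intro: key_cards.intros)
  then show "M \<in> key_cards v a" if "M \<in> range (\<lambda>i. ((\<lambda>m. m + v m) ^^ i) a)" for M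
    using that by auto
qed

text \<open>The walk never moves backwards, so labels before its start are never read.\<close>

lemma key_cards_upd:
  assumes "m < a"
  shows "key_cards (v(m := x)) a = key_cards v a"
proof (intro equalityI subsetI)
  fix M assume "M \<in> key_cards (v(m := x)) a"
  then show "M \<in> key_cards v a"
  proof (induction rule: key_cards.induct)
    case (jump k)
    then have "m \<noteq> k" using key_cards_ge[of k v a] assms by auto
    then show ?case using jump by (auto intro: key_cards.intros)
  qed (rule key_cards.first)
next
  fix M assume "M \<in> key_cards v a"
  then show "M \<in> key_cards (v(m := x)) a"
  proof (induction rule: key_cards.induct)
    case (jump k)
    then have "m \<noteq> k" using key_cards_ge[of k v a] assms by auto
    then show ?case using key_cards.jump[OF jump.IH] by auto
  qed (rule key_cards.first)
qed

lemma coupling_time_gt_iff: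
  "coupling_time v a b > enat N \<longleftrightarrow> (\<forall>M \<in> key_cards v a \<inter> key_cards v b. N < M)"
  by (simp add: coupling_time_def Suc_ile_eq[symmetric] le_INF_iff Suc_le_eq)

lemma coupling_time_commute: "coupling_time v a b = coupling_time v b a"
  by (simp add: coupling_time_def Int_commute)

lemma coupling_time_same: "coupling_time v a a \<le> enat a"
  unfolding coupling_time_def by (intro INF_lower) (auto intro: key_cards.first)

lemma coupling_time_ge: "enat (max a b) \<le> coupling_time v a b"
  unfolding coupling_time_def by (auto intro!: INF_greatest dest: key_cards_ge)

lemma coupling_time_upd:
  assumes "m < a" "m < b"
  shows "coupling_time (v(m := x)) a b = coupling_time v a b"
  using assms by (simp add: coupling_time_def key_cards_upd)

lemma coupling_time_step:
  assumes "a < b"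
  shows "coupling_time v a b = coupling_time v (a + v a) b"
proof -
  have "a \<notin> key_cards v b" using assms key_cards_ge[of a v b] by auto
  then show ?thesis unfolding coupling_time_def by (subst (1) key_cards_step) auto
qed

subsection \<open>The random deck\<close>

definition deck :: "nat \<Rightarrow> (nat \<Rightarrow> nat) measure" where
  "deck B = (\<Pi>\<^sub>M m\<in>{1..}. uniform_label B)"

lemma kruskal_measure_deck:
  "kruskal_measure B = uniform_label B \<Otimes>\<^sub>M uniform_label B \<Otimes>\<^sub>M deck B"
  by (simp add: kruskal_measure_def deck_def)

lemma space_uniform_label [simp]: "space (uniform_label B) = UNIV"
  by (simp add: uniform_label_def)

lemma sets_uniform_label: "sets (uniform_label B) = sets (count_space UNIV)"
  by (simp add: uniform_label_def)

lemma prob_space_uniform_label: "prob_space (uniform_label B)"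
  unfolding uniform_label_def by (rule prob_space_measure_pmf)

lemma prob_space_deck: "prob_space (deck B)"
  unfolding deck_def by (intro prob_space_PiM prob_space_uniform_label)

lemma nn_integral_uniform_label:
  assumes "1 \<le> B"
  shows "(\<integral>\<^sup>+x. f x \<partial>uniform_label B) = (\<Sum>x\<in>{1..B}. f x) / B"
  unfolding uniform_label_def using assms by (subst nn_integral_pmf_of_set) auto

lemma ennreal_sum_divide:
  assumes "\<And>x. x \<in> A \<Longrightarrow> 0 \<le> f x" "1 \<le> n"
  shows "(\<Sum>x\<in>A. ennreal (f x)) / of_nat n = ennreal ((\<Sum>x\<in>A. f x) / real n)"
proof -
  have "(\<Sum>x\<in>A. ennreal (f x)) = ennreal (\<Sum>x\<in>A. f x)"
    using assms(1) by (rule sum_ennreal)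
  then show ?thesis
    unfolding ennreal_of_nat_eq_real_of_nat using assms by (simp add: divide_ennreal sum_nonneg)
qed

lemma measurable_card [measurable]: "(\<lambda>v. v m) \<in> measurable (deck B) (count_space UNIV)"
proof (cases "m \<ge> 1")
  case True
  then have "(\<lambda>v. v m) \<in> measurable (deck B) (uniform_label B)"
    unfolding deck_def by (intro measurable_component_singleton) auto
  then show ?thesis
    using measurable_cong_sets[OF refl sets_uniform_label] by blast
next
  \<comment> \<open>Position 0 is outside the index set, so there every deck takes the constant
    value \<open>undefined\<close>.\<close>
  case False
  then have "(\<lambda>v. v m) \<in> measurable (deck B) (count_space UNIV) \<longleftrightarrow>
      (\<lambda>v. undefined :: nat) \<in> measurable (deck B) (count_space UNIV)"
    by (intro measurable_cong) (auto simp: deck_def space_PiM PiE_def extensional_def)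
  then show ?thesis by simp
qed

lemma measurable_coupling_time [measurable]:
  "Measurable.pred (deck B) (\<lambda>v. coupling_time v a b > enat N)"
proof -
  \<comment> \<open>The position whose card is read next is itself random; it is handled by
    splitting over its countably many values.\<close>
  have pos [measurable]: "(\<lambda>v. ((\<lambda>m. m + v m) ^^ i) c) \<in> measurable (deck B) (count_space UNIV)" for i c
  proof (induction i)
    case (Suc i)
    have "(\<lambda>v. m + v m) \<in> measurable (deck B) (count_space UNIV)" for m
      by (rule measurable_compose[OF measurable_card]) simp
    from measurable_compose_countable[where f = "\<lambda>m v. m + v m", OF this Suc] show ?case by simp
  qed simp
  show ?thesis
    unfolding coupling_time_gt_iff key_cards_eq_range Ball_def Int_iff image_iff Bex_def
    by measurable
qed

text \<open>Conditioning on one card: overwriting it with a fresh independent label preserves the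
  product law, and Fubini averages over that label.\<close>

lemma deck_resample:
  assumes "1 \<le> B" "1 \<le> m" and Q [measurable]: "Measurable.pred (deck B) Q"
  shows "emeasure (deck B) {v \<in> space (deck B). Q v} =
    (\<Sum>x\<in>{1..B}. emeasure (deck B) {v \<in> space (deck B). Q (v(m := x))}) / B"
proof -
  interpret prob_space "deck B" by (rule prob_space_deck)
  let ?U = "uniform_label B" and ?f = "\<lambda>(x, v). v(m := x)"
  \<comment> \<open>Since \<open>m\<close> is already an index, the map overwrites a card instead of
    adding one.\<close>
  have ins: "insert m {1..} = {1..}" using assms by auto
  have eq: "distr (?U \<Otimes>\<^sub>M deck B) (deck B) ?f = deck B"
    using distr_pair_PiM_eq_PiM[of "{1..}" "\<lambda>_. ?U" m] prob_space_uniform_label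
    unfolding ins deck_def by auto
  have f [measurable]: "?f \<in> measurable (?U \<Otimes>\<^sub>M deck B) (deck B)"
    unfolding split_beta' deck_def by (rule measurable_fun_upd[of _ "{1..}"]) (use assms in auto)
  have "emeasure (deck B) {v \<in> space (deck B). Q v} =
      emeasure (distr (?U \<Otimes>\<^sub>M deck B) (deck B) ?f) {v \<in> space (deck B). Q v}"
    by (simp only: eq)
  also have "\<dots> = emeasure (?U \<Otimes>\<^sub>M deck B)
      (?f -` {v \<in> space (deck B). Q v} \<inter> space (?U \<Otimes>\<^sub>M deck B))"
    by (rule emeasure_distr) measurable
  also have "\<dots> = (\<integral>\<^sup>+x. emeasure (deck B)
      (Pair x -` (?f -` {v \<in> space (deck B). Q v} \<inter> space (?U \<Otimes>\<^sub>M deck B))) \<partial>?U)"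
    by (rule emeasure_pair_measure_alt) (rule measurable_sets[OF f], measurable)
  also have "\<dots> = (\<integral>\<^sup>+x. emeasure (deck B) {v \<in> space (deck B). Q (v(m := x))} \<partial>?U)"
    using measurable_space[OF f]
    by (intro nn_integral_cong arg_cong[where f = "emeasure (deck B)"])
      (auto simp: space_pair_measure)
  also have "\<dots> = (\<Sum>x\<in>{1..B}. emeasure (deck B) {v \<in> space (deck B). Q (v(m := x))}) / B"
    using assms by (simp add: nn_integral_uniform_label)
  finally show ?thesis .
qed

text \<open>Resampling the rear card \<open>m\<close> reproduces the recursion. After its jump both
  players stand beyond \<open>m\<close>, so the remaining coupling time ignores the label just read
  and the original deck can be restored.\<close>

lemma emeasure_deck_coupling_time:
  assumes "1 \<le> d" "d < B" "1 \<le> m"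
  shows "emeasure (deck B) {v \<in> space (deck B). coupling_time v m (m + d) > enat (m + n)}
    = ennreal (survival B n d)"
  using assms
proof (induction n d arbitrary: m rule: survival_induct)
  case (stop n d)
  have "coupling_time v m (m + d) > enat (m + n)" for v
    using stop coupling_time_ge[of m "m + d" v] by (auto intro: less_le_trans[rotated])
  then show ?case
    using stop prob_space.emeasure_space_1[OF prob_space_deck] by (simp add: survival_stop)
next
  case (step n d)
  let ?E = "\<lambda>a b. emeasure (deck B) {v \<in> space (deck B). coupling_time v a b > enat (m + n)}"
  have "?E m (m + d) = (\<Sum>x\<in>{1..B}. emeasure (deck B)
      {v \<in> space (deck B). coupling_time (v(m := x)) m (m + d) > enat (m + n)}) / B"
    using step by (intro deck_resample) auto
  also have "(\<Sum>x\<in>{1..B}. emeasure (deck B)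
      {v \<in> space (deck B). coupling_time (v(m := x)) m (m + d) > enat (m + n)}) =
      (\<Sum>x\<in>{1..B}. ?E (m + x) (m + d))"
    using step by (intro sum.cong refl) (simp add: coupling_time_step coupling_time_upd)
  also have "\<dots> = ?E (m + d) (m + d) + (\<Sum>x\<in>{1..B} - {d}. ?E (m + x) (m + d))"
    using step by (intro sum.remove) auto
  \<comment> \<open>The label \<open>d\<close> lands on the front key card, at a position within the
    window because \<open>d \<le> n\<close>.\<close>
  also have "?E (m + d) (m + d) = 0"
  proof -
    have "\<not> coupling_time v (m + d) (m + d) > enat (m + n)" for v
      using coupling_time_same[of v "m + d"] step.hyps
      by (simp add: not_less) (meson add_left_mono enat_ord_simps(1) order_trans)
    then show ?thesis by simp
  qed
  also have "(\<Sum>x\<in>{1..B} - {d}. ?E (m + x) (m + d)) =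
      (\<Sum>x\<in>{1..B} - {d}. ennreal (survival B (n - min d x) (max d x - min d x)))"
  proof (rule sum.cong[OF refl])
    fix x assume x: "x \<in> {1..B} - {d}"
    \<comment> \<open>If the jump overtakes the other player, the roles of rear and front are
      exchanged by symmetry.\<close>
    have "?E (m + x) (m + d) = ?E (m + min d x) (m + min d x + (max d x - min d x))"
      by (cases "x \<le> d") (auto simp: min_def max_def coupling_time_commute)
    moreover have "m + min d x + (n - min d x) = m + n" using step.hyps by auto
    ultimately show "?E (m + x) (m + d) = ennreal (survival B (n - min d x) (max d x - min d x))"
      using step.IH[OF x, of "m + min d x"] step.prems by (simp only: trans_le_add1)
  qed
  also have "(0 + \<dots>) / B = ennreal (survival B n d)"
    unfolding survival_step[OF step.hyps(1,3)] add_0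
    using step.hyps by (intro ennreal_sum_divide survival_nonneg gap_bounds) auto
  finally show ?case .
qed

section \<open>Random secret numbers and transfer of the decay rate\<close>

lemma measurable_coupling_time_kruskal:
  "Measurable.pred (kruskal_measure B) (\<lambda>(r, s, v). coupling_time v r s > enat N)"
proof -
  have fst' [measurable]: "fst \<in> measurable (uniform_label B \<Otimes>\<^sub>M M) (count_space UNIV)"
    for M :: "'a measure"
    using measurable_fst measurable_cong_sets[OF refl sets_uniform_label] by blast
  have r: "(\<lambda>x. fst x) \<in> measurable (kruskal_measure B) (count_space UNIV)"
    unfolding kruskal_measure_deck by (rule fst')
  have s: "(\<lambda>x. fst (snd x)) \<in> measurable (kruskal_measure B) (count_space UNIV)"
    unfolding kruskal_measure_deck by (rule measurable_compose[OF measurable_snd fst'])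
  have v: "(\<lambda>x. snd (snd x)) \<in> measurable (kruskal_measure B) (deck B)"
    unfolding kruskal_measure_deck by (rule measurable_compose[OF measurable_snd measurable_snd])
  have "Measurable.pred (kruskal_measure B)
      (\<lambda>x. (\<lambda>r x. (\<lambda>s x. coupling_time (snd (snd x)) r s > enat N) (fst (snd x)) x) (fst x) x)"
    by (rule measurable_compose_countable[OF _ r], rule measurable_compose_countable[OF _ s],
        rule measurable_compose[OF v measurable_coupling_time])
  then show ?thesis by (simp add: split_beta')
qed

lemma emeasure_kruskal:
  assumes "1 \<le> B" and A: "A \<in> sets (kruskal_measure B)"
  shows "emeasure (kruskal_measure B) A =
    (\<Sum>r\<in>{1..B}. (\<Sum>s\<in>{1..B}. emeasure (deck B) {v. (r, s, v) \<in> A}) / B) / B"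
proof -
  interpret D: prob_space "deck B" by (rule prob_space_deck)
  interpret U: prob_space "uniform_label B" by (rule prob_space_uniform_label)
  interpret UD: pair_prob_space "uniform_label B" "deck B" ..
  have A': "A \<in> sets (uniform_label B \<Otimes>\<^sub>M uniform_label B \<Otimes>\<^sub>M deck B)"
    using A by (simp add: kruskal_measure_deck)
  have "emeasure (kruskal_measure B) A =
      (\<Sum>r\<in>{1..B}. emeasure (uniform_label B \<Otimes>\<^sub>M deck B) (Pair r -` A)) / B"
    unfolding kruskal_measure_deck using assms(1)
    by (simp add: UD.emeasure_pair_measure_alt[OF A'] nn_integral_uniform_label)
  also have "\<dots> = (\<Sum>r\<in>{1..B}. (\<Sum>s\<in>{1..B}. emeasure (deck B) (Pair s -` Pair r -` A)) / B) / B"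
    using assms(1)
    by (simp add: D.emeasure_pair_measure_alt[OF sets_Pair1[OF A']] nn_integral_uniform_label)
  finally show ?thesis by (simp add: vimage_def)
qed

text \<open>Meaningful for \<open>r, s \<le> B \<le> N\<close> only, since for small \<open>N\<close> the subtraction \<open>N - min r s\<close> truncates and
  equal secret numbers need not have coupled yet.\<close>
definition survival_from :: "nat \<Rightarrow> nat \<Rightarrow> nat \<Rightarrow> nat \<Rightarrow> real" where
  "survival_from B N r s =
    (if r = s then 0 else survival B (N - min r s) (max r s - min r s))"

lemma emeasure_survival_from:
  assumes "r \<in> {1..B}" "s \<in> {1..B}" "B \<le> N"
  shows "emeasure (deck B) {v \<in> space (deck B). coupling_time v r s > enat N}
    = ennreal (survival_from B N r s)"
proof (cases "r = s")
  case True
  have "\<not> coupling_time v s s > enat N" for v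
    using order_trans[OF coupling_time_same[of v s], of "enat N"] assms by (simp add: not_less)
  then show ?thesis using True by (simp add: survival_from_def)
next
  case False
  have "coupling_time v r s = coupling_time v (min r s) (min r s + (max r s - min r s))" for v
    by (cases "r \<le> s") (auto simp: min_def max_def coupling_time_commute)
  moreover have "min r s + (N - min r s) = N" using assms by auto
  moreover have "emeasure (deck B) {v \<in> space (deck B).
      coupling_time v (min r s) (min r s + (max r s - min r s)) > enat (min r s + (N - min r s))}
    = ennreal (survival B (N - min r s) (max r s - min r s))"
    using assms False by (intro emeasure_deck_coupling_time) auto
  ultimately show ?thesis using False by (simp only: survival_from_def if_False)
qed

lemma survival_from_nonneg:
  assumes "r \<in> {1..B}" "s \<in> {1..B}"
  shows "0 \<le> survival_from B N r s"
  unfolding survival_from_def using assms by (auto intro!: survival_nonneg)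

lemma prob_coupling_time:
  assumes "1 \<le> B" "B \<le> N"
  shows "\<P>((r, s, v) in kruskal_measure B. coupling_time v r s > enat N) =
    (\<Sum>r\<in>{1..B}. \<Sum>s\<in>{1..B}. survival_from B N r s) / real B ^ 2"
proof -
  let ?A = "{(r, s, v) \<in> space (kruskal_measure B). coupling_time v r s > enat N}"
  have A: "?A \<in> sets (kruskal_measure B)"
    using predE[OF measurable_coupling_time_kruskal] by (simp add: split_beta')
  have slice: "{v. (r, s, v) \<in> ?A} = {v \<in> space (deck B). coupling_time v r s > enat N}" for r s
    by (auto simp: kruskal_measure_deck space_pair_measure)
  have "emeasure (kruskal_measure B) ?A =
      (\<Sum>r\<in>{1..B}. (\<Sum>s\<in>{1..B}. ennreal (survival_from B N r s)) / B) / B"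
    unfolding emeasure_kruskal[OF assms(1) A] slice
    using assms(2) by (simp add: emeasure_survival_from)
  also have "\<dots> = ennreal ((\<Sum>r\<in>{1..B}. (\<Sum>s\<in>{1..B}. survival_from B N r s) / B) / B)"
    using assms by (simp only: ennreal_sum_divide survival_from_nonneg sum_nonneg divide_nonneg_nonneg of_nat_0_le_iff cong: sum.cong)
  also have "(\<Sum>r\<in>{1..B}. (\<Sum>s\<in>{1..B}. survival_from B N r s) / B) / B =
      (\<Sum>r\<in>{1..B}. \<Sum>s\<in>{1..B}. survival_from B N r s) / real B ^ 2"
    by (simp add: power2_eq_square sum_divide_distrib[symmetric])
  finally show ?thesis
    by (simp only: measure_def)
      (intro enn2real_ennreal divide_nonneg_nonneg sum_nonneg survival_from_nonneg; simp)
qed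

text \<open>Label 2 keeps gap 1 and advances the rear by one, so each extra position costs at most a
  factor \<open>B\<close>.\<close>

lemma survival_1_le_power:
  assumes "2 \<le> B"
  shows "survival B n 1 \<le> real B ^ k * survival B (n + k) 1"
proof (induction k)
  case (Suc k)
  have "survival B (n + k) 1 \<le> real B * survival B (n + Suc k) 1"
    using survival_1_ge[of 1 B "n + Suc k"] assms by simp
  then have "real B ^ k * survival B (n + k) 1 \<le> real B ^ k * (real B * survival B (n + Suc k) 1)"
    by (intro mult_left_mono) auto
  with Suc show ?case by (simp add: mult_ac)
qed simp

lemma survival_from_le:
  assumes "2 \<le> B" "B \<le> N" "r \<in> {1..B}" "s \<in> {1..B}"
  shows "survival_from B N r s \<le> real B ^ (B + 1) * survival B N 1"
proof (cases "r = s")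
  case True
  then show ?thesis using assms by (simp add: survival_from_def survival_nonneg)
next
  case False
  \<comment> \<open>Chosen so that \<open>survival_1_ge\<close> applies with horizon
    \<open>?j - 1 = N - min r s\<close>; another \<open>min r s - 1\<close> positions restore the
    horizon \<open>N\<close>.\<close>
  let ?j = "N + 1 - min r s"
  have j: "N - min r s = ?j - 1" "?j + (min r s - 1) = N" using assms by auto
  have "survival B (N - min r s) (max r s - min r s) \<le> real B * survival B ?j 1"
    unfolding j(1) using assms False by (intro survival_1_ge) auto
  also have "\<dots> \<le> real B * (real B ^ (min r s - 1) * survival B N 1)"
    using survival_1_le_power[OF assms(1), of ?j "min r s - 1"] unfolding j(2)
    by (intro mult_left_mono) auto
  also have "\<dots> \<le> real B * (real B ^ B * survival B N 1)"
    using assms by (intro mult_left_mono mult_right_mono power_increasing survival_nonneg) auto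
  finally show ?thesis using False by (simp add: survival_from_def mult_ac)
qed

text \<open>The lower bound keeps only the secret numbers 1 and 2, a pair of probability 1/B^2. Both
  constants are crude but independent of \<open>N\<close>, so they disappear in the exponential
  rate.\<close>

lemma prob_coupling_time_bounds:
  assumes "2 \<le> B" "B \<le> N"
  defines "p \<equiv> \<P>((r, s, v) in kruskal_measure B. coupling_time v r s > enat N)"
  shows "survival B N 1 / real B ^ 2 \<le> p" "p \<le> real B ^ (B + 1) * survival B N 1"
proof -
  have p: "p = (\<Sum>r\<in>{1..B}. \<Sum>s\<in>{1..B}. survival_from B N r s) / real B ^ 2"
    unfolding p_def using assms by (intro prob_coupling_time) auto
  have "survival B N 1 \<le> survival B (N - 1) 1"
    using assms by (intro survival_antimono) auto
  also have "\<dots> = survival_from B N 1 2"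
    by (simp add: survival_from_def)
  also have "\<dots> \<le> (\<Sum>s\<in>{1..B}. survival_from B N 1 s)"
    using assms by (intro member_le_sum) (auto intro: survival_from_nonneg)
  also have "\<dots> \<le> (\<Sum>r\<in>{1..B}. \<Sum>s\<in>{1..B}. survival_from B N r s)"
    using assms by (intro member_le_sum[where f = "\<lambda>r. \<Sum>s\<in>{1..B}. survival_from B N r s"])
      (auto intro!: survival_from_nonneg sum_nonneg)
  finally show "survival B N 1 / real B ^ 2 \<le> p"
    unfolding p by (rule divide_right_mono) simp
  have "(\<Sum>r\<in>{1..B}. \<Sum>s\<in>{1..B}. survival_from B N r s)
      \<le> (\<Sum>r\<in>{1..B}. \<Sum>s\<in>{1..B}. real B ^ (B + 1) * survival B N 1)"
    by (intro sum_mono survival_from_le assms)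
  also have "\<dots> = real B ^ 2 * (real B ^ (B + 1) * survival B N 1)"
    by (simp add: power2_eq_square)
  finally show "p \<le> real B ^ (B + 1) * survival B N 1"
    unfolding p using assms by (simp add: pos_divide_le_eq mult_ac)
qed

lemma tendsto_ln_prob_coupling_time:
  assumes "2 \<le> B"
  shows "(\<lambda>N. - ln \<P>((r, s, v) in kruskal_measure B. coupling_time v r s > enat N) / N)
    \<longlonglongrightarrow> decay_rate B"
proof -
  define p where "p N = \<P>((r, s, v) in kruskal_measure B. coupling_time v r s > enat N)" for N
  let ?u = "\<lambda>N. survival B N 1"
  have u: "?u N > 0" for N using assms by (intro survival_pos) auto
  have bounds: "- ln (?u N) / N - (B + 1) * ln B / N \<le> - ln (p N) / N \<and>
      - ln (p N) / N \<le> - ln (?u N) / N + 2 * ln B / N" if "N \<ge> B" for N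
  proof -
    have low: "?u N / real B ^ 2 \<le> p N" and up: "p N \<le> real B ^ (B + 1) * ?u N"
      unfolding p_def by (intro prob_coupling_time_bounds assms that)+
    have pos: "0 < ?u N / real B ^ 2" using u[of N] assms by simp
    then have p_pos: "0 < p N" using low by (rule less_le_trans)
    have "ln (?u N / real B ^ 2) \<le> ln (p N)"
      using pos p_pos low by (subst ln_le_cancel_iff) auto
    then have "ln (?u N) - 2 * ln B \<le> ln (p N)"
      using u[of N] assms by (simp add: ln_div ln_realpow)
    moreover have "ln (p N) \<le> ln (real B ^ (B + 1) * ?u N)"
      using p_pos up u[of N] assms by (subst ln_le_cancel_iff) auto
    then have "ln (p N) \<le> (B + 1) * ln B + ln (?u N)"
      using u[of N] assms by (subst (asm) ln_mult) (auto simp: ln_realpow simp del: power_Suc)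
    ultimately show ?thesis
      unfolding diff_divide_distrib[symmetric] add_divide_distrib[symmetric]
      by (intro conjI divide_right_mono) auto
  qed
  have "(\<lambda>N. - ln (p N) / N) \<longlonglongrightarrow> decay_rate B"
  proof (rule tendsto_sandwich)
    show "(\<lambda>N. - ln (?u N) / N - (B + 1) * ln B / N) \<longlonglongrightarrow> decay_rate B"
      using tendsto_diff[OF tendsto_decay_rate[OF assms] lim_const_over_n] by fastforce
    show "(\<lambda>N. - ln (?u N) / N + 2 * ln B / N) \<longlonglongrightarrow> decay_rate B"
      using tendsto_add[OF tendsto_decay_rate[OF assms] lim_const_over_n] by fastforce
  qed (use bounds in \<open>auto intro!: eventually_mono[OF eventually_ge_at_top[of B]]\<close>)
  then show ?thesis unfolding p_def .
qed

theorem mainTheorem4: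
  shows "\<exists>\<alpha> :: nat \<Rightarrow> real.
    (\<lambda>B. \<alpha> B - 4 / real B ^ 2) \<in> O(\<lambda>B. 1 / real B ^ 3) \<and>
    (\<forall>B\<ge>2. \<exists>\<epsilon> :: nat \<Rightarrow> real. \<epsilon> \<longlonglongrightarrow> 0 \<and>
      (\<forall>\<^sub>F N in sequentially.
        \<P>((r, s, v) in kruskal_measure B. coupling_time v r s > enat N)
          = exp (- \<alpha> B * (1 + \<epsilon> N) * real N)))"
proof (rule exI[of _ decay_rate], intro conjI allI impI decay_rate_asymp)
  fix B :: nat assume B: "B \<ge> 2"
  define p where "p N = \<P>((r, s, v) in kruskal_measure B. coupling_time v r s > enat N)" for N
  \<comment> \<open>Obtained by solving the claimed identity for the error term, which requires a
    nonzero rate. The identity is then exact for all \<open>N \<ge> B\<close>, where the bounds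
    above make \<open>p N\<close> positive.\<close>
  define \<epsilon> where "\<epsilon> N = (- ln (p N) / real N) / decay_rate B - 1" for N
  have pos: "decay_rate B > 0" using B by (rule decay_rate_pos)
  have "\<epsilon> \<longlonglongrightarrow> decay_rate B / decay_rate B - 1"
    unfolding \<epsilon>_def p_def using pos
    by (intro tendsto_intros tendsto_ln_prob_coupling_time B) auto
  then have "\<epsilon> \<longlonglongrightarrow> 0" using pos by simp
  moreover have "\<forall>\<^sub>F N in sequentially. p N = exp (- decay_rate B * (1 + \<epsilon> N) * real N)"
    using eventually_ge_at_top[of B]
  proof eventually_elim
    case (elim N)
    have "0 < survival B N 1 / real B ^ 2" using survival_pos[of 1 B N] B by simp
    also have "\<dots> \<le> p N" unfolding p_def using B elim by (rule prob_coupling_time_bounds)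
    finally have "p N = exp (ln (p N))" by simp
    also have "ln (p N) = - decay_rate B * (1 + \<epsilon> N) * real N"
      using pos B elim by (simp add: \<epsilon>_def)
    finally show ?case .
  qed
  ultimately show "\<exists>\<epsilon> :: nat \<Rightarrow> real. \<epsilon> \<longlonglongrightarrow> 0 \<and> (\<forall>\<^sub>F N in sequentially.
      \<P>((r, s, v) in kruskal_measure B. coupling_time v r s > enat N)
        = exp (- decay_rate B * (1 + \<epsilon> N) * real N))"
    unfolding p_def by blast
qed

end
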